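(* Let $d,g\in\mathbb{Q}[x]$ be non-zero polynomials with $\gcd(d,g)=1$ and $\deg(g)<\deg(d)$, and let $(\mathcal{F}_n)_{n\ge 0}$ be the associated Fibonacci-type sequence. Let $\beta=\mathrm{lc}(d)$, $\eta=\deg(d)$, $\omega=\deg(g)$, $\rho=\mathrm{Res}(g,d)$. Then for all positive integers $n,m$, $$\mathrm{Res}(\mathcal{F}_n,\mathcal{F}_m)=\begin{cases}0 & \text{if }\gcd(m,n)>1,\\ \left((-1)^{\eta\omega}\beta^{2\eta-\omega}\rho\right)^{\frac{(n-1)(m-1)}{2}} & \text{otherwise.}\end{cases}$$
   Context: The Fibonacci-type sequence associated with $d,g$ is defined by $\mathcal{F}_0=0$, $\mathcal{F}_1=1$, $\mathcal{F}_n=d\,\mathcal{F}_{n-1}+g\,\mathcal{F}_{n-2}$ for $n\ge 2$. $\mathrm{lc}(P)$ and $\deg(P)$ denote the leading coefficient and degree of $P$. For non-zero $P,Q\in\mathbb{Q}[x]$ of degrees $n,m$ with leading coefficients $a_n,b_m$ and complex roots $x_1,\dots,x_n$ and $y_1,\dots,y_m$ (with multiplicity), $\mathrm{Res}(P,Q)$ is the determinant of the Sylvester matrix of $P,Q$; equivalently $\mathrm{Res}(P,Q)=a_n^m b_m^n\prod_{i,j}(x_i-y_j)=a_n^m\prod_i Q(x_i)$. In particular $\mathrm{Res}(k,f)=\mathrm{Res}(f,k)=k^{\deg f}$ for a non-zero constant $k$. *)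

theory Defs
  imports
    "HOL-Computational_Algebra.Polynomial_Factorial"
    "HOL-Computational_Algebra.Field_as_Ring"
    "Subresultants.Resultant_Prelim"
begin

fun fib_seq :: "'a::comm_semiring_1 \<Rightarrow> 'a \<Rightarrow> nat \<Rightarrow> 'a" where
  "fib_seq d g 0 = 0"
| "fib_seq d g (Suc 0) = 1"
| "fib_seq d g (Suc (Suc n)) = d * fib_seq d g (Suc n) + g * fib_seq d g n"

end

theory Submission
  imports
    (* Defs comes last so that degree and lead_coeff denote the constants of
       HOL-Computational_Algebra and not the homonyms of HOL-Algebra.Polynomials. *)
    "HOL-Algebra.Algebraic_Closure_Type"
    "Subresultants.Subresultant"
    Defs
begin

text \<open>The resultant is multiplicative in each argument, and up to a power of the leading coefficient
  \<open>Res(P, Q)\<close> depends only on \<open>Q\<close> modulo \<open>P\<close>; both follow from its expression as a product over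
  the roots of \<open>P\<close> in an algebraic closure. Let \<open>K\<close> be the base of the power in the theorem. As
  \<open>F\<^sub>n \<equiv> d\<^bsup>n-1\<^esup>\<close> modulo \<open>g\<close> and \<open>F\<^sub>n\<^sub>+\<^sub>1 \<equiv> g F\<^sub>n\<^sub>-\<^sub>1\<close> modulo \<open>F\<^sub>n\<close>, we get
  \<open>Res(F\<^sub>n, F\<^sub>n\<^sub>+\<^sub>1) = K\<^bsup>n-1\<^esup> Res(F\<^sub>n\<^sub>-\<^sub>1, F\<^sub>n)\<close>, hence \<open>Res(F\<^sub>n, F\<^sub>n\<^sub>+\<^sub>1) = K\<^bsup>n(n-1)/2\<^esup>\<close>.
  The addition formula \<open>F\<^sub>n\<^sub>+\<^sub>k = F\<^sub>k F\<^sub>n\<^sub>+\<^sub>1 + g F\<^sub>k\<^sub>-\<^sub>1 F\<^sub>n\<close> then gives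
  \<open>Res(F\<^sub>n, F\<^sub>n\<^sub>+\<^sub>k) = Res(F\<^sub>n, F\<^sub>k) Res(F\<^sub>n, F\<^sub>n\<^sub>+\<^sub>1)\<close>, and the coprime case follows by
  the subtractive Euclidean algorithm on the indices. If \<open>k > 1\<close> divides \<open>n\<close> and \<open>m\<close>, then
  \<open>F\<^sub>k\<close> is a non-constant common factor.\<close>

section \<open>Resultants as products over roots\<close>

text \<open>The resultant is the constant coefficient of the subresultant of index 0, so this is the
  effect of a division step on subresultants; constant \<open>H\<close> falls under a separate
  identity.\<close>

lemma resultant_euclid_step:
  fixes F G H B :: "'a :: idom poly"
  assumes FGH: "F + B * G = H" and HG: "degree H < degree G" and GF: "degree G \<le> degree F"
  shows "resultant F G =
    (-1) ^ (degree F * degree G) * lead_coeff G ^ (degree F - degree H) * resultant G H"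
proof (cases "degree H = 0")
  case False
  then show ?thesis
    using arg_cong[OF BT_lemma_1_12[OF FGH GF, of 0], of "\<lambda>p. coeff p 0"] HG
    by (simp add: coeff_subresultant_0_0_resultant)
next
  case True
  then obtain h where h: "H = [:h:]" by (rule degree_eq_zeroE)
  have "h ^ (degree G - Suc 0) * h = h ^ degree G"
    using HG by (metis gr_implies_not0 not_gr_zero power_minus_mult One_nat_def)
  then show ?thesis
    using arg_cong[OF BT_eq_19[OF FGH GF, of 0], of "\<lambda>p. coeff p 0"] HG h
    by (simp add: coeff_subresultant_0_0_resultant mult.assoc)
qed

lemma poly_prod_linear_factors_root:
  fixes A :: "'a :: comm_ring_1 multiset"
  assumes "x \<in># A"
  shows "poly (\<Prod>y\<in>#A. [:- y, 1:]) x = 0"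
  using assms by (induction A) auto

text \<open>Both sides are \<open>a ^ size B * b ^ size A\<close> times the product of all
  \<open>x - y\<close>; the sign comes from reversing every difference.\<close>

lemma prod_mset_poly_roots_swap:
  fixes A B :: "'a :: idom multiset"
  assumes F: "F = smult a (\<Prod>x\<in>#A. [:- x, 1:])" and G: "G = smult b (\<Prod>y\<in>#B. [:- y, 1:])"
  shows "a ^ size B * (\<Prod>x\<in>#A. poly G x) =
    (-1) ^ (size A * size B) * (b ^ size A * (\<Prod>y\<in>#B. poly F y))"
proof -
  have poly_prod: "poly (\<Prod>y\<in>#C. [:- y, 1:]) = (\<lambda>x. \<Prod>y\<in>#C. x - y)"
    for C :: "'a multiset"
    by (induction C) (auto simp: algebra_simps)
  have const: "(\<Prod>x\<in>#C. c * f x) = c ^ size C * (\<Prod>x\<in>#C. f x)"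
    for C :: "'a multiset" and c :: 'a and f by (simp add: prod_mset.distrib)
  have "(\<Prod>x\<in>#A. \<Prod>y\<in>#B. x - y) = (\<Prod>y\<in>#B. \<Prod>x\<in>#A. - 1 * (y - x))"
    by (subst prod_mset.swap) simp
  also have "\<dots> = (\<Prod>y\<in>#B. (-1) ^ size A * (\<Prod>x\<in>#A. y - x))"
    by (subst const) (rule refl)
  also have "\<dots> = (-1) ^ (size A * size B) * (\<Prod>y\<in>#B. \<Prod>x\<in>#A. y - x)"
    by (subst const) (simp add: power_mult)
  finally show ?thesis
    unfolding F G poly_smult poly_prod const by (simp add: mult_ac)
qed

lemma smult_prod_linear_factors:
  fixes A :: "'a :: idom multiset"
  assumes "F = smult a (\<Prod>x\<in>#A. [:- x, 1:])" and "F \<noteq> 0"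
  shows "degree F = size A" and "lead_coeff F = a"
proof -
  have *: "degree (\<Prod>x\<in>#C. [:- x, 1:]) = size C \<and> lead_coeff (\<Prod>x\<in>#C. [:- x, 1:]) = 1"
    for C :: "'a multiset"
  proof (induction C)
    case (add x C)
    let ?P = "\<Prod>x\<in>#C. [:- x, 1:]"
    have "?P \<noteq> 0" using add by auto
    then have "degree ([:- x, 1:] * ?P) = Suc (size C)"
      using add by (subst degree_mult_eq) auto
    moreover have "lead_coeff ([:- x, 1:] * ?P) = 1"
      using add by (subst lead_coeff_mult) auto
    ultimately show ?case by simp
  qed simp
  show "degree F = size A" "lead_coeff F = a"
    using *[of A] assms by auto
qed

text \<open>Induction along the Euclidean algorithm: division replaces the pair \<open>F\<close>,
  \<open>G\<close> by \<open>G\<close>, \<open>H\<close>, and exchanging the root products returns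
  to the roots of \<open>F\<close>.\<close>

lemma resultant_eq_prod_roots:
  fixes F G :: "'a :: alg_closed_field poly"
  assumes F: "F = smult a (\<Prod>x\<in>#A. [:- x, 1:])" and "F \<noteq> 0"
  shows "resultant F G = a ^ degree G * (\<Prod>x\<in>#A. poly G x)"
proof -
  \<comment> \<open>The division step needs this degree bound; the other case follows by swapping
    the arguments.\<close>
  have main: "resultant F G = a ^ degree G * (\<Prod>x\<in>#A. poly G x)"
    if "F = smult a (\<Prod>x\<in>#A. [:- x, 1:])" "F \<noteq> 0" "degree G \<le> degree F"
    for F G :: "'a poly" and a A
    using that
  proof (induction "degree G" arbitrary: F G a A rule: less_induct)
    case less
    note dF = smult_prod_linear_factors[OF less.prems(1,2)]
    show ?case
    proof (cases "degree G = 0")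
      case True
      then obtain c where "G = [:c:]" by (rule degree_eq_zeroE)
      moreover have "poly [:c:] = (\<lambda>_. c)" by auto
      ultimately show ?thesis using dF by simp
    next
      case False
      then have "G \<noteq> 0" by auto
      then obtain B where B: "G = smult (lead_coeff G) (\<Prod>y\<in>#B. [:- y, 1:])"
        using alg_closed_imp_factorization by blast
      note dG = smult_prod_linear_factors[OF B \<open>G \<noteq> 0\<close>]
      define H where "H = F mod G"
      have H: "F + (- (F div G)) * G = H"
        by (simp add: H_def minus_div_mult_eq_mod)
      have HG: "degree H < degree G"
        using degree_mod_less[of G F] \<open>G \<noteq> 0\<close> False by (auto simp: H_def)
      have "poly H y = poly F y" if "y \<in># B" for y
      proof -
        have "poly G y = 0"
          by (subst B) (simp only: poly_smult poly_prod_linear_factors_root[OF that] mult_zero_right)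
        then show ?thesis by (simp flip: H)
      qed
      then have "resultant G H = lead_coeff G ^ degree H * (\<Prod>y\<in>#B. poly F y)"
        using less.hyps[OF HG B \<open>G \<noteq> 0\<close>] HG by (simp cong: image_mset_cong)
      then have "resultant F G = (-1) ^ (degree F * degree G)
          * (lead_coeff G ^ degree F * (\<Prod>y\<in>#B. poly F y))"
        using resultant_euclid_step[OF H HG less.prems(3)] HG less.prems(3)
        by (simp flip: power_add add: mult_ac)
      then show ?thesis
        using prod_mset_poly_roots_swap[OF less.prems(1) B] dF dG by simp
    qed
  qed
  show ?thesis
  proof (cases "degree G \<le> degree F")
    case True
    then show ?thesis using main assms by blast
  next
    case False
    then have "G \<noteq> 0" by auto
    then obtain B where B: "G = smult (lead_coeff G) (\<Prod>y\<in>#B. [:- y, 1:])"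
      using alg_closed_imp_factorization by blast
    show ?thesis
      using main[OF B \<open>G \<noteq> 0\<close>, of F] False prod_mset_poly_roots_swap[OF F B]
        smult_prod_linear_factors[OF assms] smult_prod_linear_factors[OF B \<open>G \<noteq> 0\<close>]
      by (simp add: resultant_swap[of F])
  qed
qed

section \<open>Multiplicativity and congruences over a field\<close>

context
begin

interpretation to_ac_hom: field_hom to_ac
  by unfold_locales auto

interpretation to_ac_poly_hom: map_poly_inj_idom_hom to_ac ..

text \<open>The product over the roots of \<open>F\<close> in the algebraic closure is
  multiplicative, and the identity descends along the injective \<open>to_ac\<close>.\<close>

lemma resultant_mult_right:
  fixes F G H :: "'a :: field poly"
  assumes "G \<noteq> 0" and "H \<noteq> 0"
  shows "resultant F (G * H) = resultant F G * resultant F H"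
proof (cases "F = 0")
  case True
  then show ?thesis
    using resultant_const(1)[of "0 :: 'a"] assms by (simp add: degree_mult_eq power_add)
next
  case False
  let ?h = "map_poly (to_ac :: 'a \<Rightarrow> _)"
  obtain A where A: "?h F = smult (lead_coeff (?h F)) (\<Prod>x\<in>#A. [:- x, 1:])"
    using alg_closed_imp_factorization[of "?h F"] False by auto
  have "resultant (?h F) (?h (G * H)) = resultant (?h F) (?h G) * resultant (?h F) (?h H)"
    using False assms
    by (simp add: resultant_eq_prod_roots[OF A] degree_mult_eq hom_distribs power_add
        prod_mset.distrib mult_ac)
  then show ?thesis by (simp add: to_ac_hom.resultant_hom flip: to_ac_mult)
qed

text \<open>\<open>G\<close> and \<open>H\<close> take the same values at the roots of
  \<open>F\<close>; the powers of the leading coefficient balance degrees that may differ.\<close>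

lemma resultant_cong_right:
  fixes F G H :: "'a :: field poly"
  assumes "F \<noteq> 0" and "F dvd G - H"
  shows "lead_coeff F ^ degree H * resultant F G = lead_coeff F ^ degree G * resultant F H"
proof -
  let ?h = "map_poly (to_ac :: 'a \<Rightarrow> _)"
  obtain A where A: "?h F = smult (lead_coeff (?h F)) (\<Prod>x\<in>#A. [:- x, 1:])"
    using alg_closed_imp_factorization[of "?h F"] assms by auto
  obtain Q where Q: "G = H + F * Q" using assms(2) by (metis dvdE add.commute diff_add_cancel)
  have "poly (?h G) x = poly (?h H) x" if "x \<in># A" for x
  proof -
    have "poly (?h F) x = 0"
      by (subst A) (simp only: poly_smult poly_prod_linear_factors_root[OF that] mult_zero_right)
    then show ?thesis by (simp add: Q hom_distribs)
  qed
  then have "lead_coeff (?h F) ^ degree H * resultant (?h F) (?h G)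
      = lead_coeff (?h F) ^ degree G * resultant (?h F) (?h H)"
    using assms(1) by (simp add: resultant_eq_prod_roots[OF A] cong: image_mset_cong)
  then show ?thesis
    by (simp add: to_ac_hom.resultant_hom flip: to_ac_mult to_ac_power)
qed

end

lemma resultant_power_right:
  fixes F G :: "'a :: field poly"
  assumes "G \<noteq> 0"
  shows "resultant F (G ^ n) = resultant F G ^ n"
  using assms by (induction n) (simp_all add: resultant_mult_right)

text \<open>\<open>F\<close> is congruent to 0 modulo \<open>C\<close>, so its resultant with
  \<open>C\<close> vanishes; multiplicativity carries this over to non-zero multiples of
  \<open>C\<close>.\<close>

lemma resultant_eq_0_if_common_factor:
  fixes C F G :: "'a :: field poly"
  assumes "C dvd F" and "C dvd G" and "degree C > 0" and "F \<noteq> 0"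
  shows "resultant F G = 0"
proof (cases "G = 0")
  case True
  then show ?thesis using assms dvd_imp_degree_le[of C F] by simp
next
  case False
  then obtain R where R: "G = C * R" "R \<noteq> 0" "C \<noteq> 0" using assms(2) by auto
  have "resultant C F = 0"
    using resultant_cong_right[of C F 0] assms R by simp
  then show ?thesis using R by (simp add: resultant_mult_right resultant_swap[of F C])
qed

section \<open>Addition formula and divisibility\<close>

text \<open>Both sides obey the defining recurrence in \<open>m\<close>, so agreement at 0 and 1
  suffices.\<close>

lemma fib_seq_add:
  "fib_seq d g (Suc (n + m)) =
    fib_seq d g (Suc m) * fib_seq d g (Suc n) + g * fib_seq d g m * fib_seq d g n"
proof (induction d g m rule: fib_seq.induct)
  case (3 d g m)
  then show ?case by (simp add: algebra_simps)
qed simp_all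

lemma fib_seq_dvd_fib_seq:
  assumes "k dvd n"
  shows "fib_seq d g k dvd fib_seq d g n"
proof (cases "k = 0")
  case True
  then show ?thesis using assms by simp
next
  case False
  then obtain k' where k': "k = Suc k'" by (cases k) auto
  have "fib_seq d g k dvd fib_seq d g (k * j)" for j
  proof (induction j)
    case (Suc j)
    have "k * Suc j = Suc (k * j + k')" using k' by simp
    then show ?case using Suc by (simp add: fib_seq_add k')
  qed simp
  then show ?thesis using assms by auto
qed

section \<open>Degrees and resultants of the sequence\<close>

context
  fixes d g :: "'a :: field poly"
  assumes g0: "g \<noteq> 0" and deg: "degree g < degree d"
begin

lemma d_nonzero: "d \<noteq> 0"
  using deg by auto

text \<open>Since \<open>degree g < degree d\<close>, the summand with \<open>d\<close> dominates
  the recurrence.\<close>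

lemma degree_lead_coeff_fib_seq:
  "degree (fib_seq d g (Suc n)) = n * degree d \<and> lead_coeff (fib_seq d g (Suc n)) = lead_coeff d ^ n"
proof (induction n rule: less_induct)
  case (less n)
  show ?case
  proof (cases n)
    case (Suc k)
    let ?A = "d * fib_seq d g (Suc k)" and ?B = "g * fib_seq d g k"
    have IH: "degree (fib_seq d g (Suc k)) = k * degree d"
      "lead_coeff (fib_seq d g (Suc k)) = lead_coeff d ^ k"
      using less[of k] Suc by auto
    then have nz: "fib_seq d g (Suc k) \<noteq> 0"
      using d_nonzero by (metis leading_coeff_0_iff power_not_zero)
    have A: "degree ?A = n * degree d" "lead_coeff ?A = lead_coeff d ^ n"
      using IH nz d_nonzero Suc
      by (simp add: degree_mult_eq, simp only: lead_coeff_mult IH(2) Suc power_Suc)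
    have "degree ?B < degree ?A"
    proof (cases k)
      case 0
      then show ?thesis using A deg Suc by simp
    next
      case (Suc j)
      have "degree ?B \<le> degree g + j * degree d"
        using degree_mult_le[of g "fib_seq d g k"] less[of j] Suc \<open>n = Suc k\<close> by simp
      then show ?thesis using A deg Suc \<open>n = Suc k\<close> by simp
    qed
    then have "degree (?A + ?B) = degree ?A \<and> lead_coeff (?A + ?B) = lead_coeff ?A"
      by (simp add: degree_add_eq_left coeff_eq_0)
    then show ?thesis using A by (auto simp only: Suc fib_seq.simps)
  qed simp
qed

lemmas degree_fib_seq = degree_lead_coeff_fib_seq[THEN conjunct1]
  and lead_coeff_fib_seq = degree_lead_coeff_fib_seq[THEN conjunct2]

lemma fib_seq_nonzero: "fib_seq d g (Suc n) \<noteq> 0"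
  using lead_coeff_fib_seq[of n] d_nonzero by (metis leading_coeff_0_iff power_not_zero)

text \<open>Modulo \<open>g\<close> the recurrence is multiplication by \<open>d\<close>, and
  \<open>d ^ n\<close> has the same degree as the term; swapping the arguments adds the
  sign.\<close>

lemma resultant_fib_seq_g:
  "resultant (fib_seq d g (Suc n)) g = ((-1) ^ (degree d * degree g) * resultant g d) ^ n"
proof -
  have "g dvd fib_seq d g (Suc n) - d ^ n"
  proof (induction n)
    case (Suc n)
    have "fib_seq d g (Suc (Suc n)) - d ^ Suc n
        = d * (fib_seq d g (Suc n) - d ^ n) + g * fib_seq d g n"
      by (simp add: algebra_simps)
    then show ?case using Suc by (metis dvd_add dvd_mult dvd_triv_left)
  qed simp
  from resultant_cong_right[OF g0 this]
  have "resultant g (fib_seq d g (Suc n)) = resultant g d ^ n"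
    using g0 d_nonzero by (simp add: degree_fib_seq degree_power_eq resultant_power_right mult.commute)
  then show ?thesis
    by (simp add: resultant_swap[of _ g] degree_fib_seq power_mult_distrib mult_ac
        flip: power_mult)
qed

text \<open>As \<open>degree g < degree d\<close>, the subtraction in the exponent is not
  truncated.\<close>

abbreviation resultant_base :: 'a where
  "resultant_base \<equiv> (-1) ^ (degree d * degree g) * lead_coeff d ^ (2 * degree d - degree g)
     * resultant g d"

lemma resultant_fib_seq_Suc:
  "resultant (fib_seq d g (Suc n)) (fib_seq d g (Suc (Suc n))) = resultant_base ^ (Suc n * n div 2)"
proof (induction n)
  case 0
  then show ?case by simp
next
  case (Suc n)
  let ?F = "fib_seq d g"
  let ?l = "lead_coeff d"
  \<comment> \<open>One of \<open>n\<close> and \<open>Suc n\<close> is even, so this swap costs no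
    sign.\<close>
  have "even (Suc n * degree d * (n * degree d))" by (cases "even n") simp_all
  then have "resultant (?F (Suc (Suc n))) (?F (Suc n)) = resultant (?F (Suc n)) (?F (Suc (Suc n)))"
    by (subst resultant_swap) (simp only: degree_fib_seq minus_one_power_iff if_True mult_1_left)
  then have swap: "resultant (?F (Suc (Suc n))) (?F (Suc n)) = resultant_base ^ (Suc n * n div 2)"
    using Suc by simp
  have "?F (Suc (Suc n)) dvd ?F (Suc (Suc (Suc n))) - g * ?F (Suc n)"
    by simp
  from resultant_cong_right[OF fib_seq_nonzero this]
  have "(?l ^ Suc n) ^ (degree g + n * degree d)
        * resultant (?F (Suc (Suc n))) (?F (Suc (Suc (Suc n))))
      = (?l ^ Suc n) ^ (Suc (Suc n) * degree d)
        * resultant (?F (Suc (Suc n))) (g * ?F (Suc n))"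
    unfolding lead_coeff_fib_seq by (simp only: degree_fib_seq degree_mult_eq[OF g0 fib_seq_nonzero])
  \<comment> \<open>The two congruent polynomials differ in degree by
    \<open>2 * degree d - degree g\<close>, which is the source of that exponent in
    \<open>resultant_base\<close>.\<close>
  moreover have "Suc (Suc n) * degree d = (degree g + n * degree d) + (2 * degree d - degree g)"
    using deg by simp
  ultimately have "resultant (?F (Suc (Suc n))) (?F (Suc (Suc (Suc n))))
      = (?l ^ Suc n) ^ (2 * degree d - degree g) * resultant (?F (Suc (Suc n))) (g * ?F (Suc n))"
    using d_nonzero by (simp only: power_add mult.assoc) simp
  also have "\<dots> = (?l ^ Suc n) ^ (2 * degree d - degree g)
      * (((-1) ^ (degree d * degree g) * resultant g d) ^ Suc n * resultant_base ^ (Suc n * n div 2))"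
    by (simp only: resultant_mult_right[OF g0 fib_seq_nonzero] resultant_fib_seq_g swap)
  also have "\<dots> = resultant_base ^ Suc n * resultant_base ^ (Suc n * n div 2)"
    by (simp only: power_mult_distrib mult_ac flip: power_mult)
  also have "\<dots> = resultant_base ^ (Suc (Suc n) * Suc n div 2)"
  proof -
    have "Suc (Suc n) * Suc n = Suc n * n + Suc n * 2" by simp
    then have "Suc (Suc n) * Suc n div 2 = Suc n + Suc n * n div 2" by presburger
    then show ?thesis by (simp only: power_add)
  qed
  finally show ?case .
qed

text \<open>Since \<open>F\<^sub>n\<^sub>+\<^sub>k\<close> and \<open>F\<^sub>k F\<^sub>n\<^sub>+\<^sub>1\<close> are congruent modulo \<open>F\<^sub>n\<close> and have the same degree,
  no leading coefficients appear.\<close>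

lemma resultant_fib_seq_add:
  "resultant (fib_seq d g (Suc n)) (fib_seq d g (Suc n + Suc k)) =
    resultant (fib_seq d g (Suc n)) (fib_seq d g (Suc k))
    * resultant (fib_seq d g (Suc n)) (fib_seq d g (Suc (Suc n)))"
proof -
  let ?F = "fib_seq d g"
  have "?F (Suc n) dvd ?F (Suc (Suc n + k)) - ?F (Suc k) * ?F (Suc (Suc n))"
    by (subst fib_seq_add) simp
  from resultant_cong_right[OF fib_seq_nonzero this]
  have "(lead_coeff d ^ n) ^ (k * degree d + Suc n * degree d)
        * resultant (?F (Suc n)) (?F (Suc (Suc n + k)))
      = (lead_coeff d ^ n) ^ ((Suc n + k) * degree d)
        * resultant (?F (Suc n)) (?F (Suc k) * ?F (Suc (Suc n)))"
    unfolding lead_coeff_fib_seq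
    by (simp only: degree_fib_seq degree_mult_eq[OF fib_seq_nonzero fib_seq_nonzero])
  moreover have "k * degree d + Suc n * degree d = (Suc n + k) * degree d"
    by (simp add: algebra_simps)
  ultimately have "resultant (?F (Suc n)) (?F (Suc (Suc n + k)))
      = resultant (?F (Suc n)) (?F (Suc k) * ?F (Suc (Suc n)))"
    using d_nonzero
    by (simp only: mult_left_cancel power_not_zero leading_coeff_0_iff not_False_eq_True)
  then show ?thesis
    by (simp only: resultant_mult_right[OF fib_seq_nonzero fib_seq_nonzero] add_Suc_right)
qed

section \<open>Coprime and non-coprime indices\<close>

lemma resultant_fib_seq_coprime:
  assumes "coprime n m" and "n > 0" and "m > 0"
  shows "resultant (fib_seq d g n) (fib_seq d g m) = resultant_base ^ ((n - 1) * (m - 1) div 2)"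
  using assms
proof (induction "n + m" arbitrary: n m rule: less_induct)
  case less
  \<comment> \<open>One of two coprime indices is odd, so its predecessor is even: halving the
    exponent is exact and a swap costs no sign.\<close>
  have ev: "even ((i - 1) * (j - 1))" if "coprime i j" for i j :: nat
    using coprime_common_divisor[of i j 2] that by auto
  have step: "resultant (fib_seq d g i) (fib_seq d g j) = resultant_base ^ ((i - 1) * (j - 1) div 2)"
    if "i < j" "0 < i" "coprime i j" "i + j = n + m" for i j
  proof -
    obtain a where a: "i = Suc a" using \<open>0 < i\<close> by (cases i) auto
    obtain b where b: "j = i + Suc b"
      using \<open>i < j\<close> less_imp_Suc_add by fastforce
    have cop: "coprime i (Suc b)"
      using \<open>coprime i j\<close> b by (simp add: coprime_iff_gcd_eq_1 del: add_Suc_right)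
    have "resultant (fib_seq d g i) (fib_seq d g (Suc b)) = resultant_base ^ (a * b div 2)"
      using less.hyps[of i "Suc b"] cop b that a by simp
    \<comment> \<open>The exponent splits into the share \<open>a * b\<close> of the smaller pair
      \<open>i\<close>, \<open>j - i\<close> and the share \<open>Suc a * a\<close> of the
      consecutive pair; both are even, so the halves add.\<close>
    moreover have "(i - 1) * (j - 1) div 2 = a * b div 2 + Suc a * a div 2"
    proof -
      have "even (a * b)" "even (Suc a * a)" using ev[OF cop] a by simp_all
      moreover have "(i - 1) * (j - 1) = a * b + Suc a * a"
        using a b by (simp add: algebra_simps)
      ultimately show ?thesis by (metis div_plus_div_distrib_dvd_left)
    qed
    ultimately show ?thesis
      using resultant_fib_seq_add[of a b] resultant_fib_seq_Suc[of a] a b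
      by (simp only: power_add)
  qed
  consider "n < m" | "n = m" | "m < n" by linarith
  then show ?case
  proof cases
    case 1
    then show ?thesis using step less.prems by simp
  next
    case 2
    then show ?thesis using less.prems by simp
  next
    case 3
    obtain i j where ij: "n = Suc i" "m = Suc j"
      using less.prems by (metis gr0_implies_Suc)
    have "even (i * j)" using ev[OF less.prems(1)] ij by simp
    then have "resultant (fib_seq d g n) (fib_seq d g m) = resultant (fib_seq d g m) (fib_seq d g n)"
      by (subst resultant_swap) (auto simp: ij degree_fib_seq minus_one_power_iff)
    then show ?thesis using step[of m n] 3 less.prems
      by (simp add: coprime_commute mult.commute add.commute)
  qed
qed

text \<open>The term at \<open>gcd n m\<close> divides both, and its degree
  \<open>(gcd n m - 1) * degree d\<close> is positive.\<close>

lemma resultant_fib_seq_not_coprime: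
  assumes "gcd n m > 1" and "n > 0"
  shows "resultant (fib_seq d g n) (fib_seq d g m) = 0"
proof (rule resultant_eq_0_if_common_factor)
  obtain k where k: "gcd n m = Suc k" "k > 0"
    using assms(1) by (metis Suc_lessE One_nat_def)
  show "degree (fib_seq d g (gcd n m)) > 0"
    using k deg by (simp add: degree_fib_seq)
  show "fib_seq d g n \<noteq> 0"
    using fib_seq_nonzero assms(2) by (metis gr0_implies_Suc)
qed (simp_all add: fib_seq_dvd_fib_seq)

end

theorem theorem1:
  fixes d g :: "rat poly" and n m :: nat
  assumes "d \<noteq> 0" and "g \<noteq> 0"
    and "gcd d g = 1"
    and "degree g < degree d"
    and "n > 0" and "m > 0"
  shows "resultant (fib_seq d g n) (fib_seq d g m) =
    (if gcd m n > 1 then 0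
     else ((-1) ^ (degree d * degree g) * lead_coeff d ^ (2 * degree d - degree g)
             * resultant g d) ^ ((n - 1) * (m - 1) div 2))"
proof (cases "gcd m n > 1")
  case True
  then show ?thesis
    using resultant_fib_seq_not_coprime[OF assms(2,4)] assms(5) by (simp add: gcd.commute)
next
  case False
  moreover have "gcd m n > 0" using assms(5) by simp
  ultimately have "gcd m n = 1" by linarith
  then have "coprime n m" by (simp add: coprime_iff_gcd_eq_1 gcd.commute)
  then show ?thesis
    using False resultant_fib_seq_coprime[OF assms(2,4)] assms(5,6) by simp
qed

end
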